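(* For all integers $n\ge1$, $\mathrm{Com}_n\equiv C_{n-1}\pmod 3$.
   Context: $\mathrm{Com}_n$ is the (integer) coefficient of $x^n$ in $F^{\langle -1\rangle}(x)$, the compositional inverse of the formal power series $F(x)=\sum_{k\ge1}k!\,x^k$. $C_n=\frac{1}{n+1}\binom{2n}{n}$ is the $n$th Catalan number. *)

theory Defs
  imports
    "HOL-Computational_Algebra.Formal_Power_Series"
    "HOL-Number_Theory.Cong"
begin

definition fact_fps :: "rat fps" where
  "fact_fps = Abs_fps (\<lambda>k. if k = 0 then 0 else fact k)"

(* The library's compositional inverse fps_inv needs a field of coefficients, hence rat.
   The floor only changes the type: see of_int_Com. *)
definition Com :: "nat \<Rightarrow> int" where
  "Com n = \<lfloor>fps_nth (fps_inv fact_fps) n\<rfloor>"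

(* The division is exact: see of_nat_catalan. *)
definition catalan :: "nat \<Rightarrow> nat" where
  "catalan n = ((2 * n) choose n) div (n + 1)"

lemma fps_inv_fact_fps: "fps_inv fact_fps oo fact_fps = fps_X" "fact_fps oo fps_inv fact_fps = fps_X"
  by (rule fps_inv fps_inv_right; simp add: fact_fps_def)+

lemma fact_fps_power_nth_Ints: "fps_nth (fact_fps ^ i) n \<in> \<int>"
proof (induction i arbitrary: n)
  case 0
  then show ?case by simp
next
  case (Suc i)
  have "fps_nth fact_fps k \<in> \<int>" for k
    by (simp add: fact_fps_def fact_in_Ints)
  with Suc show ?case
    by (auto simp: fps_mult_nth intro!: Ints_sum Ints_mult)
qed

lemma compinv_fact_fps_Ints: "compinv fact_fps n \<in> \<int>"
proof (induction n rule: less_induct)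
  case (less n)
  show ?case
  proof (cases n)
    case 0
    then show ?thesis by simp
  next
    case (Suc m)
    have "(\<Sum>i = 0..m. compinv fact_fps i * fps_nth (fact_fps ^ i) (Suc m)) \<in> \<int>"
      using less Suc by (intro Ints_sum Ints_mult fact_fps_power_nth_Ints) auto
    moreover have "fps_nth fact_fps 1 = 1"
      by (simp add: fact_fps_def)
    ultimately show ?thesis
      using Suc by (simp add: fps_X_def)
  qed
qed

lemma of_int_Com: "of_int (Com n) = fps_nth (fps_inv fact_fps) n"
  using compinv_fact_fps_Ints[of n] by (simp add: Com_def fps_inv_def)

lemma Suc_dvd_central_binomial: "(n + 1) dvd ((2 * n) choose n)"
proof -
  have "(n + 1) * ((2 * n) choose (n + 1)) = n * ((2 * n) choose n)"
    using binomial_absorb_comp[of "2 * n" n] binomial_absorption[of n "2 * n"]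
    by (simp only: Suc_eq_plus1 mult_2 diff_add_inverse)
  then have "(n + 1) dvd n * ((2 * n) choose n)"
    by (metis dvd_triv_left)
  then show ?thesis
    by (metis coprime_add_one_left coprime_dvd_mult_right_iff)
qed

lemma of_nat_catalan: "(of_nat (catalan n) :: rat) = 1 / of_nat (n + 1) * of_nat ((2 * n) choose n)"
proof -
  have "(n + 1) * catalan n = (2 * n) choose n"
    using Suc_dvd_central_binomial[of n] unfolding catalan_def by (rule dvd_mult_div_cancel)
  then have "of_nat (n + 1) * (of_nat (catalan n) :: rat) = of_nat ((2 * n) choose n)"
    by (metis of_nat_mult)
  then show ?thesis
    by (simp add: field_simps)
qed

end

theory Submission
  imports Defs
begin

text \<open>
  Since \<open>3 dvd k!\<close> for \<open>k \<ge> 3\<close>, the series \<open>\<Sum>k\<ge>1. k! x\<^sup>k\<close> reduces modulo 3 to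
  \<open>x + 2 x\<^sup>2 = x - x\<^sup>2\<close>.  So the generating function \<open>G\<close> of \<open>Com\<close> satisfies
  \<open>G - G\<^sup>2 = x\<close> modulo 3 (\<open>Com_quadratic_mod_3\<close>).  The shifted Catalan generating function
  \<open>c = \<Sum>n\<ge>1. C\<^sub>n\<^sub>-\<^sub>1 x\<^sup>n\<close> satisfies \<open>c - c\<^sup>2 = x\<close> exactly (\<open>catalan_quadratic\<close>), because
  \<open>1 - 2 c\<close> is the binomial series of \<open>(1 - 4 x)\<^bsup>1/2\<^esup>\<close>.  A power series without constant term
  is determined modulo \<open>m\<close> by its \<open>a - a\<^sup>2\<close> modulo \<open>m\<close> (\<open>cong_fps_if_cong_quadratic\<close>),
  hence \<open>G = c\<close> modulo 3.
\<close>

definition Com_fps :: "int fps" where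
  "Com_fps = Abs_fps Com"

definition catalan_fps :: "int fps" where
  "catalan_fps = Abs_fps (\<lambda>n. if n = 0 then 0 else int (catalan (n - 1)))"

text \<open>
  The difference \<open>d = a - b\<close> satisfies \<open>d = d (a + b)\<close> modulo \<open>m\<close>.  As \<open>a + b\<close> has no constant
  term, each coefficient of \<open>d\<close> is thereby a combination of earlier ones, modulo \<open>m\<close>.
\<close>
lemma cong_fps_if_cong_quadratic:
  fixes a b :: "'a :: unique_euclidean_ring fps"
  assumes "fps_nth a 0 = 0" "fps_nth b 0 = 0"
    and eq: "\<And>n. [fps_nth (a - a\<^sup>2) n = fps_nth (b - b\<^sup>2) n] (mod m)"
  shows "[fps_nth a n = fps_nth b n] (mod m)"
proof -
  define d where "d = a - b"
  have "m dvd fps_nth d n"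
  proof (induction n rule: less_induct)
    case (less n)
    have "m dvd fps_nth d i * fps_nth (a + b) (n - i)" if "i \<in> {0..n}" for i
    proof (cases "i = n")
      case True
      then show ?thesis using assms by simp
    next
      case False
      then show ?thesis using less that by simp
    qed
    then have prod: "m dvd fps_nth (d * (a + b)) n"
      unfolding fps_mult_nth by (intro dvd_sum)
    have "(a - a\<^sup>2) - (b - b\<^sup>2) = d - d * (a + b)"
      by (simp add: d_def power2_eq_square algebra_simps)
    then have "m dvd fps_nth (d - d * (a + b)) n"
      using eq[of n] by (metis cong_iff_dvd_diff fps_sub_nth)
    from dvd_add[OF this prod] show ?case by simp
  qed
  then show ?thesis
    by (simp add: d_def cong_iff_dvd_diff)
qed

lemma of_int_Com_fps_power_nth:
  "of_int (fps_nth (Com_fps ^ i) n) = fps_nth (fps_inv fact_fps ^ i) n"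
proof (induction i arbitrary: n)
  case 0
  then show ?case by simp
next
  case (Suc i)
  then show ?case
    by (simp add: fps_mult_nth Com_fps_def of_int_Com)
qed

lemma Com_fps_nth_0: "fps_nth Com_fps 0 = 0"
proof -
  have "of_int (Com 0) = (0 :: rat)"
    unfolding of_int_Com by (simp add: fps_inv_def)
  then show ?thesis by (simp add: Com_fps_def)
qed

text \<open>
  The rational identity \<open>fps_inv_fact_fps\<close>, read off coefficientwise, is an identity
  between integers, where congruences make sense.
\<close>
lemma sum_fact_Com_fps_power_nth:
  "(\<Sum>k=1..n. fact k * fps_nth (Com_fps ^ k) n) = fps_nth (fps_X :: int fps) n"
proof -
  have "(of_int (\<Sum>k=1..n. fact k * fps_nth (Com_fps ^ k) n) :: rat)
      = (\<Sum>k=1..n. fps_nth fact_fps k * fps_nth (fps_inv fact_fps ^ k) n)"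
    by (simp add: of_int_Com_fps_power_nth fact_fps_def)
  also have "\<dots> = (\<Sum>k=0..n. fps_nth fact_fps k * fps_nth (fps_inv fact_fps ^ k) n)"
    by (rule sum.mono_neutral_left) (auto simp: fact_fps_def Suc_le_eq)
  also have "\<dots> = fps_nth (fact_fps oo fps_inv fact_fps) n"
    by (simp add: fps_compose_nth)
  also have "\<dots> = of_int (fps_nth fps_X n)"
    by (simp add: fps_inv_fact_fps fps_X_def)
  finally show ?thesis
    unfolding of_int_eq_iff .
qed

lemma Com_quadratic_mod_3:
  "[fps_nth (Com_fps - Com_fps\<^sup>2) n = fps_nth fps_X n] (mod 3)"
proof -
  have two_interval: "{1..2::nat} = {1, 2}"
    by auto
  let ?t = "\<lambda>k. fact k * fps_nth (Com_fps ^ k) n"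
  \<comment> \<open>Powers beyond the \<open>n\<close>-th do not reach \<open>x\<^sup>n\<close>, so the sum may be extended; this makes
    the terms \<open>k = 1, 2\<close> present for every \<open>n\<close>.\<close>
  have "fps_nth fps_X n = sum ?t {1..n + 2}"
    unfolding sum_fact_Com_fps_power_nth[symmetric]
    by (rule sum.mono_neutral_left) (auto simp: startsby_zero_power_prefix Com_fps_nth_0)
  also have "{1..n + 2} = {1..2} \<union> {3..n + 2}"
    by auto
  also have "sum ?t \<dots> = sum ?t {1..2} + sum ?t {3..n + 2}"
    by (rule sum.union_disjoint) auto
  also have "sum ?t {1..2} = fps_nth Com_fps n + 2 * fps_nth (Com_fps\<^sup>2) n"
    unfolding two_interval by simp
  finally have "fps_nth (Com_fps - Com_fps\<^sup>2) n - fps_nth fps_X n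
      = - (3 * fps_nth (Com_fps\<^sup>2) n + sum ?t {3..n + 2})"
    by simp
  moreover have "(3 :: int) dvd fact k" if "3 \<le> k" for k
    using that dvd_fact[of 3 k] int_dvd_int_iff[of 3 "fact k"] by simp
  then have "3 dvd sum ?t {3..n + 2}"
    by (intro dvd_sum dvd_mult2) simp
  then have "3 dvd - (3 * fps_nth (Com_fps\<^sup>2) n + sum ?t {3..n + 2})"
    by (simp only: dvd_minus_iff dvd_add dvd_triv_left)
  ultimately show ?thesis
    unfolding cong_iff_dvd_diff by metis
qed

lemma catalan_Suc: "of_nat (m + 2) * (of_nat (catalan (Suc m)) :: rat)
    = of_nat (4 * m + 2) * of_nat (catalan m)"
proof -
  have fact_eq: "of_nat (n + 1) * of_nat (catalan n) * (fact n)\<^sup>2 = (fact (2 * n) :: rat)" for n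
    by (simp add: of_nat_catalan binomial_fact power2_eq_square mult_2 del: of_nat_Suc)
  let ?c = "(of_nat (m + 1))\<^sup>2 * (fact m)\<^sup>2 :: rat"
  have "?c * (of_nat (m + 2) * of_nat (catalan (Suc m))) = fact (2 * Suc m)"
    unfolding fact_eq[of "Suc m", symmetric] by (simp add: power_mult_distrib mult_ac)
  also have "\<dots> = of_nat (2 * m + 2) * of_nat (2 * m + 1) * fact (2 * m)"
    by (simp add: algebra_simps)
  also have "\<dots> = ?c * (of_nat (4 * m + 2) * of_nat (catalan m))"
    unfolding fact_eq[of m, symmetric] by (simp add: power2_eq_square algebra_simps)
  finally have "?c * (of_nat (m + 2) * of_nat (catalan (Suc m))) = ?c * (of_nat (4 * m + 2) * of_nat (catalan m))" .
  moreover have "?c \<noteq> 0"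
    by (simp del: of_nat_add)
  ultimately show ?thesis
    using mult_left_cancel by blast
qed

text \<open>
  Both sides satisfy the two-term recurrence \<open>(m + 2) u\<^sub>m\<^sub>+\<^sub>1 = (4 m + 2) u\<^sub>m\<close> with the same
  initial value.
\<close>
lemma half_gbinomial_eq_catalan:
  "((1 / 2) gchoose Suc m) * (-4) ^ Suc m = (-2 :: rat) * of_nat (catalan m)"
proof (induction m)
  case 0
  then show ?case by (simp add: catalan_def)
next
  case (Suc m)
  let ?g = "\<lambda>k. ((1 / 2 :: rat) gchoose k)"
  have rec: "of_nat (m + 2) * ?g (Suc (Suc m)) = (1 / 2 - of_nat (Suc m)) * ?g (Suc m)"
    using gbinomial_mult_1[of "1 / 2 :: rat" "Suc m"] by (simp add: algebra_simps)
  have "of_nat (m + 2) * (?g (Suc (Suc m)) * (-4) ^ Suc (Suc m))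
      = (of_nat (m + 2) * ?g (Suc (Suc m))) * (-4) ^ Suc (Suc m)"
    by (simp only: mult.assoc)
  also have "\<dots> = of_nat (4 * m + 2) * (?g (Suc m) * (-4) ^ Suc m)"
    unfolding rec by (simp add: algebra_simps)
  also have "\<dots> = of_nat (m + 2) * (-2 * of_nat (catalan (Suc m)))"
    unfolding Suc using catalan_Suc[of m] by (simp add: algebra_simps)
  also have "of_nat (m + 2) * (?g (Suc (Suc m)) * (-4) ^ Suc (Suc m)) = \<dots>
      \<longleftrightarrow> ?case"
    by (rule mult_left_cancel) (simp del: of_nat_add)
  finally show ?case .
qed

text \<open>
  The coefficients of \<open>1 - 2 c\<close> are those of the binomial series of \<open>(1 - 4 x)\<^bsup>1/2\<^esup>\<close>, so
  Vandermonde's identity with both upper arguments \<open>1/2\<close> gives \<open>(1 - 2 c)\<^sup>2 = 1 - 4 x\<close>.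
\<close>
lemma catalan_quadratic: "catalan_fps - catalan_fps\<^sup>2 = fps_X"
proof -
  define s where "s = 1 - 2 * catalan_fps"
  have s_nth: "of_int (fps_nth s k) = ((1 / 2 :: rat) gchoose k) * (-4) ^ k" for k
  proof (cases k)
    case 0
    then show ?thesis by (simp add: s_def catalan_fps_def)
  next
    case (Suc m)
    then show ?thesis
      unfolding Suc half_gbinomial_eq_catalan
      by (simp add: s_def catalan_fps_def numeral_fps_const)
  qed
  have "fps_nth (s\<^sup>2) n = fps_nth (1 - 4 * fps_X) n" for n
  proof -
    have "(of_int (fps_nth (s\<^sup>2) n) :: rat)
        = (\<Sum>k=0..n. ((1 / 2 gchoose k) * (1 / 2 gchoose (n - k))) * ((-4) ^ k * (-4) ^ (n - k)))"
      unfolding power2_eq_square fps_mult_nth of_int_sum of_int_mult s_nth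
      by (simp add: mult_ac)
    also have "\<dots> = (\<Sum>k=0..n. (1 / 2 gchoose k) * (1 / 2 gchoose (n - k))) * (-4) ^ n"
      unfolding sum_distrib_right by (intro sum.cong) (simp_all flip: power_add)
    also have "\<dots> = (1 gchoose n) * (-4) ^ n"
      using gbinomial_Vandermonde[of "1 / 2 :: rat" "1 / 2" n] by (simp add: atLeast0AtMost)
    also have "\<dots> = of_nat (1 choose n) * (-4) ^ n"
      using binomial_gbinomial[of 1 n, where ?'a = rat] by simp
    also have "\<dots> = of_int (fps_nth (1 - 4 * fps_X) n)"
      by (cases n rule: nat.exhaust; cases "n \<le> 1")
        (auto simp: numeral_fps_const le_Suc_eq binomial_eq_0 fps_X_def)
    finally show ?thesis
      unfolding of_int_eq_iff .
  qed
  then have "s\<^sup>2 = 1 - 4 * fps_X"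
    by (rule fps_ext)
  then have "4 * (catalan_fps - catalan_fps\<^sup>2) = 4 * fps_X"
    by (simp add: s_def power2_eq_square algebra_simps)
  then show ?thesis
    by (subst (asm) mult_cancel_left) simp
qed

theorem proposition13:
  fixes n :: nat
  assumes "n \<ge> 1"
  shows "[Com n = int (catalan (n - 1))] (mod 3)"
proof -
  have "[fps_nth Com_fps n = fps_nth catalan_fps n] (mod 3)"
    by (rule cong_fps_if_cong_quadratic)
      (simp_all only: catalan_quadratic Com_quadratic_mod_3 Com_fps_nth_0, simp add: catalan_fps_def)
  with assms show ?thesis
    by (simp add: Com_fps_def catalan_fps_def)
qed

end
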